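(* Let $\beta\in(0,1)$ and let $N(t)$ be the generator process with Sibuya waiting-time density $\psi_\beta(t)=(-1)^{t-1}\binom{\beta}{t}$, $t\in\mathbb{N}$. Then the transition matrix of the Sibuya ADTRW is, for every $t\in\mathbb{N}_0$, $$\mathbf{P}(t)=\frac{(-1)^t}{t!}\sum_{n=0}^t(\mathbf{W}^-)^{t-n}(\mathbf{W}^+)^n\sum_{\ell=0}^n(-1)^\ell\binom{n}{\ell}\frac{\Gamma(\beta(\ell+1))}{\Gamma(\beta(\ell+1)-t)}.$$
   Context: For real $\beta$, $\binom{\beta}{t}=\beta(\beta-1)\cdots(\beta-t+1)/t!$, and $1/\Gamma$ is taken to be $0$ at non-positive integers. The generator process with waiting-time density $\psi$ is the discrete-time renewal counting process $N(t)=\max\{n\ge0:\Delta t_1+\dots+\Delta t_n\le t\}$, $t\in\mathbb{N}_0$, with $\Delta t_1,\Delta t_2,\dots$ i.i.d., $\mathbb{P}(\Delta t_j=t)=\psi(t)$. $\mathbf{W}^+$ and $\mathbf{W}^-$ are stochastic matrices indexed by $\mathbb{Z}\times\mathbb{Z}$ that are Toeplitz ($W^\pm_{p,q}=W^\pm_{p+s,q+s}$ for all $s\in\mathbb{Z}$; hence they commute), with $W^+_{p,q}=0$ unless $q>p$ and $W^-_{p,q}=0$ unless $q<p$. The ADTRW (asymmetric discrete-time random walk) generated by $N$ makes at each integer time a jump governed by $\mathbf{W}^+$ if an arrival of $N$ occurs and by $\mathbf{W}^-$ otherwise; its transition matrix is $\mathbf{P}(t)=\sum_{n=0}^t\mathbb{P}(N(t)=n)(\mathbf{W}^+)^n(\mathbf{W}^-)^{t-n}$.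 It is called the Sibuya ADTRW when $N$ has Sibuya waiting times $\psi_\beta$. *)

theory Defs
  imports "HOL-Probability.Probability"
begin

type_synonym zmatrix = "int \<Rightarrow> int \<Rightarrow> real"

text \<open>For the stochastic matrices considered here all the series defining matrix products converge
  absolutely.\<close>

definition zmat_mult :: "zmatrix \<Rightarrow> zmatrix \<Rightarrow> zmatrix" where
  "zmat_mult A B = (\<lambda>p q. \<Sum>\<^sub>\<infinity>r\<in>UNIV. A p r * B r q)"

definition zmat_one :: zmatrix where
  "zmat_one = (\<lambda>p q. if p = q then 1 else 0)"

primrec zmat_power :: "zmatrix \<Rightarrow> nat \<Rightarrow> zmatrix" where
  "zmat_power A 0 = zmat_one"
| "zmat_power A (Suc n) = zmat_mult A (zmat_power A n)"

definition zmat_stochastic :: "zmatrix \<Rightarrow> bool" where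
  "zmat_stochastic W \<longleftrightarrow> (\<forall>p q. 0 \<le> W p q) \<and> (\<forall>p. (W p has_sum 1) UNIV)"

definition zmat_toeplitz :: "zmatrix \<Rightarrow> bool" where
  "zmat_toeplitz W \<longleftrightarrow> (\<forall>p q s. W p q = W (p + s) (q + s))"

text \<open>Waiting times take values in the positive integers, so a waiting-time density has the value 0
  at 0. They are numbered from 1 on.\<close>

definition sibuya_density :: "real \<Rightarrow> nat \<Rightarrow> real" where
  "sibuya_density \<beta> t = (if t = 0 then 0 else (-1) ^ (t - 1) * (\<beta> gchoose t))"

definition iid_waiting_times :: "'a measure \<Rightarrow> (nat \<Rightarrow> real) \<Rightarrow> (nat \<Rightarrow> 'a \<Rightarrow> nat) \<Rightarrow> bool" where
  "iid_waiting_times M \<psi> \<Delta> \<longleftrightarrow>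
     prob_space.indep_vars M (\<lambda>_. count_space UNIV) \<Delta> {1..} \<and>
     (\<forall>j\<ge>1. \<forall>t. measure M {\<omega> \<in> space M. \<Delta> j \<omega> = t} = \<psi> t)"

text \<open>If \<open>iid_waiting_times M \<psi> \<Delta>\<close> with \<open>\<psi> 0 = 0\<close>, the set below is almost surely finite;
  it always contains 0.\<close>

definition counting_process :: "(nat \<Rightarrow> 'a \<Rightarrow> nat) \<Rightarrow> nat \<Rightarrow> 'a \<Rightarrow> nat" where
  "counting_process \<Delta> t \<omega> = Max {n. (\<Sum>j=1..n. \<Delta> j \<omega>) \<le> t}"

definition adtrw_transition ::
    "'a measure \<Rightarrow> (nat \<Rightarrow> 'a \<Rightarrow> nat) \<Rightarrow> zmatrix \<Rightarrow> zmatrix \<Rightarrow> nat \<Rightarrow> zmatrix" where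
  "adtrw_transition M N Wp Wm t = (\<lambda>p q.
     \<Sum>n=0..t. measure M {\<omega> \<in> space M. N t \<omega> = n} *
       zmat_mult (zmat_power Wp n) (zmat_power Wm (t - n)) p q)"

end

theory Submission
  imports Defs "HOL-Computational_Algebra.Formal_Power_Series"
begin

text \<open>Conditioning on the number of arrivals reduces everything to the law of \<open>N t\<close>, and the
  law is a coefficient extraction. The waiting times have generating function
  \<open>1 - (1 - X)\<^sup>\<beta>\<close>, so by independence the \<open>n\<close>-th arrival epoch \<open>S\<^sub>n\<close> has generating function
  \<open>(1 - (1 - X)\<^sup>\<beta>)\<^sup>n\<close> (\<open>prob_arrival_epoch\<close>). Since \<open>N t = n\<close> means
  \<open>S\<^sub>n \<le> t < S\<^sub>n\<^sub>+\<^sub>1\<close> almost surely, its probability is the difference of two cumulative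
  probabilities, whose generating functions carry an additional factor \<open>(1 - X)\<^sup>-\<^sup>1\<close>. Hence
  \<open>P(N t = n)\<close> is the coefficient of \<open>X\<^sup>t\<close> in
  \<open>(1 - (1 - X)\<^sup>\<beta>)\<^sup>n (1 - X)\<^sup>\<beta>\<^sup>-\<^sup>1\<close>.
  Expanding the \<open>n\<close>-th power by the binomial theorem leaves a combination of the series
  \<open>(1 - X)\<^sup>a\<^sup>-\<^sup>1\<close> with \<open>a = \<beta>(l + 1)\<close>, whose coefficients
  \<open>(-1)\<^sup>t (a - 1 gchoose t)\<close> are the quotients of Gamma values in the theorem
  (\<open>gbinomial_eq_Gamma_rGamma\<close>).

  The formula has the two matrix powers in the opposite order from the definition of the walk;
  they may be exchanged because multiplication of Toeplitz matrices is convolution on \<open>\<int>\<close>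
  (\<open>zmat_mult_toeplitz_commute\<close>).\<close>

section \<open>Toeplitz matrices commute\<close>

lemma zmat_toeplitzD: "zmat_toeplitz A \<Longrightarrow> q - p = s - r \<Longrightarrow> A p q = A r s"
  unfolding zmat_toeplitz_def by (metis add.commute diff_add_cancel add_diff_cancel_left' diff_add_eq)

text \<open>The reflection \<open>r \<mapsto> p + q - r\<close> of the summation index exchanges the two factors
  termwise, so that the two sums agree whether or not they converge.\<close>

lemma zmat_mult_toeplitz_commute:
  assumes "zmat_toeplitz A" "zmat_toeplitz B"
  shows "zmat_mult A B = zmat_mult B A"
proof (intro ext)
  fix p q :: int
  have bij: "bij_betw (\<lambda>r. p + q - r) UNIV UNIV"
    by (rule bij_betwI[where g = "\<lambda>r. p + q - r"]) auto
  have "zmat_mult A B p q = (\<Sum>\<^sub>\<infinity>r\<in>UNIV. A p (p + q - r) * B (p + q - r) q)"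
    unfolding zmat_mult_def
    using infsum_reindex_bij_betw[OF bij, of "\<lambda>r. A p r * B r q"] by simp
  also have "\<dots> = (\<Sum>\<^sub>\<infinity>r\<in>UNIV. B p r * A r q)"
  proof (rule infsum_cong)
    fix r :: int
    have "A p (p + q - r) = A r q" "B (p + q - r) q = B p r"
      by (auto intro: zmat_toeplitzD assms)
    then show "A p (p + q - r) * B (p + q - r) q = B p r * A r q"
      by simp
  qed
  finally show "zmat_mult A B p q = zmat_mult B A p q"
    by (simp add: zmat_mult_def)
qed

lemma zmat_toeplitz_mult:
  assumes "zmat_toeplitz A" "zmat_toeplitz B"
  shows "zmat_toeplitz (zmat_mult A B)"
  unfolding zmat_toeplitz_def
proof (intro allI)
  fix p q s :: int
  have bij: "bij_betw (\<lambda>r. r + s) UNIV UNIV"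
    by (rule bij_betwI[where g = "\<lambda>r. r - s"]) auto
  have "zmat_mult A B (p + s) (q + s) = (\<Sum>\<^sub>\<infinity>r\<in>UNIV. A (p + s) (r + s) * B (r + s) (q + s))"
    unfolding zmat_mult_def
    using infsum_reindex_bij_betw[OF bij, of "\<lambda>r. A (p + s) r * B r (q + s)"] by simp
  also have "\<dots> = (\<Sum>\<^sub>\<infinity>r\<in>UNIV. A p r * B r q)"
    using assms unfolding zmat_toeplitz_def by metis
  finally show "zmat_mult A B p q = zmat_mult A B (p + s) (q + s)"
    by (simp add: zmat_mult_def)
qed

lemma zmat_toeplitz_power: "zmat_toeplitz A \<Longrightarrow> zmat_toeplitz (zmat_power A n)"
proof (induction n)
  case 0
  show ?case by (simp add: zmat_toeplitz_def zmat_one_def)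
qed (simp add: zmat_toeplitz_mult)

section \<open>Powers of \<open>1 - X\<close>\<close>

text \<open>The formal power series \<open>(1 - X)\<^sup>a\<close>.\<close>

definition fps_one_minus_powr :: "real \<Rightarrow> real fps" where
  "fps_one_minus_powr a = Abs_fps (\<lambda>t. (-1) ^ t * (a gchoose t))"

lemma fps_one_minus_powr_nth [simp]:
  "fps_nth (fps_one_minus_powr a) t = (-1) ^ t * (a gchoose t)"
  by (simp add: fps_one_minus_powr_def)

lemma fps_one_minus_powr_eq_compose:
  "fps_one_minus_powr a = fps_compose (fps_binomial a) (- fps_X)"
  by (rule fps_ext) (simp add: fps_compose_uminus')

lemma fps_one_minus_powr_mult:
  "fps_one_minus_powr a * fps_one_minus_powr b = fps_one_minus_powr (a + b)"
  by (simp add: fps_one_minus_powr_eq_compose fps_binomial_add_mult fps_compose_mult_distrib)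

lemma fps_one_minus_powr_0: "fps_one_minus_powr 0 = 1"
  by (rule fps_ext) (auto simp: gbinomial_0_left)

lemma fps_one_minus_powr_power:
  "fps_one_minus_powr a ^ n = fps_one_minus_powr (real n * a)"
  by (induction n) (simp_all add: fps_one_minus_powr_0 fps_one_minus_powr_mult algebra_simps)

lemma fps_one_minus_powr_minus_one_nth: "fps_nth (fps_one_minus_powr (-1)) t = 1"
  using gbinomial_minus[of "1::real" t]
  by (simp add: binomial_gbinomial[symmetric] power_mult_distrib[symmetric])

text \<open>The case \<open>a = -1\<close> is the geometric series, so multiplication by it forms partial sums.\<close>

lemma sum_fps_nth_le: "(\<Sum>s\<le>t. fps_nth f s) = fps_nth (f * fps_one_minus_powr (-1)) t"
  unfolding fps_mult_nth by (simp del: fps_one_minus_powr_nth add: fps_one_minus_powr_minus_one_nth atMost_atLeast0)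

lemma sibuya_fps: "Abs_fps (sibuya_density \<beta>) = 1 - fps_one_minus_powr \<beta>"
proof (rule fps_ext)
  fix n
  show "fps_nth (Abs_fps (sibuya_density \<beta>)) n = fps_nth (1 - fps_one_minus_powr \<beta>) n"
    by (cases n) (auto simp: sibuya_density_def)
qed

text \<open>Using \<open>rGamma\<close> covers the poles as well: if \<open>a\<close> is an integer with \<open>a \<le> t\<close>, then
  both sides vanish.\<close>

lemma gbinomial_eq_Gamma_rGamma:
  fixes a :: real
  assumes "a > 0"
  shows "(a - 1) gchoose t = Gamma a * rGamma (a - real t) / fact t"
proof -
  have "rGamma (a - real t) = pochhammer (a - real t) t * rGamma a"
    using pochhammer_rGamma[of "a - real t" t] by simp
  moreover have "Gamma a * rGamma a = 1"
    using Gamma_real_pos[OF assms] by (simp add: rGamma_inverse_Gamma)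
  ultimately have "Gamma a * rGamma (a - real t) = pochhammer (a - real t) t"
    by (simp add: algebra_simps)
  then show ?thesis
    by (simp add: gbinomial_pochhammer')
qed

lemma fps_nth_sibuya_count:
  fixes \<beta> :: real
  assumes "\<beta> > 0"
  shows "fps_nth ((1 - fps_one_minus_powr \<beta>) ^ n * fps_one_minus_powr (\<beta> - 1)) t =
    (-1) ^ t / fact t * (\<Sum>l=0..n. (-1) ^ l * real (n choose l) *
      (Gamma (\<beta> * (real l + 1)) * rGamma (\<beta> * (real l + 1) - real t)))"
proof -
  let ?B = fps_one_minus_powr
  have pw: "(- ?B \<beta>) ^ l = fps_const ((-1) ^ l) * ?B (real l * \<beta>)" for l
    by (subst power_minus)
       (simp add: fps_one_minus_powr_power fps_const_power[symmetric] fps_const_neg[symmetric] del: fps_const_power fps_const_neg)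
  have "(1 - ?B \<beta>) ^ n = (\<Sum>l\<le>n. of_nat (n choose l) * (- ?B \<beta>) ^ l)"
    using binomial_ring[of "- ?B \<beta>" 1 n] by simp
  then have "(1 - ?B \<beta>) ^ n * ?B (\<beta> - 1) =
      (\<Sum>l\<le>n. of_nat (n choose l) * fps_const ((-1) ^ l) * (?B (real l * \<beta>) * ?B (\<beta> - 1)))"
    by (simp add: pw sum_distrib_right mult.assoc)
  also have "\<dots> = (\<Sum>l\<le>n. fps_const (real (n choose l) * (-1) ^ l) * ?B (\<beta> * (real l + 1) - 1))"
    by (simp add: fps_one_minus_powr_mult fps_of_nat[symmetric] algebra_simps)
  finally have "fps_nth ((1 - ?B \<beta>) ^ n * ?B (\<beta> - 1)) t =
      (\<Sum>l\<le>n. real (n choose l) * (-1) ^ l * ((-1) ^ t * ((\<beta> * (real l + 1) - 1) gchoose t)))"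
    by (simp add: fps_sum_nth)
  also have "\<dots> = (\<Sum>l\<le>n. (-1) ^ t / fact t * ((-1) ^ l * real (n choose l) *
      (Gamma (\<beta> * (real l + 1)) * rGamma (\<beta> * (real l + 1) - real t))))"
    using assms by (intro sum.cong refl) (subst gbinomial_eq_Gamma_rGamma, auto)
  finally show ?thesis
    by (simp add: sum_distrib_left atMost_atLeast0)
qed

section \<open>The law of the counting process\<close>

context prob_space
begin

lemma iid_waiting_times_measurable:
  assumes "iid_waiting_times M \<psi> \<Delta>" "j \<ge> 1"
  shows "\<Delta> j \<in> measurable M (count_space UNIV)"
  using assms unfolding iid_waiting_times_def indep_vars_def2 by auto

lemma arrival_epoch_measurable:
  assumes "iid_waiting_times M \<psi> \<Delta>"
  shows "(\<lambda>\<omega>. \<Sum>j=1..n. \<Delta> j \<omega>) \<in> measurable M (count_space UNIV)"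
proof -
  have "(\<lambda>\<omega>. \<Sum>j=1..n. \<Delta> j \<omega>) \<in> borel_measurable M"
    using iid_waiting_times_measurable[OF assms]
    by (intro borel_measurable_sum) (auto simp: measurable_cong_sets[OF refl sets_borel_eq_count_space])
  then show ?thesis
    by (simp add: measurable_cong_sets[OF refl sets_borel_eq_count_space])
qed

lemma arrival_epoch_indep:
  assumes "iid_waiting_times M \<psi> \<Delta>"
  shows "indep_var (count_space UNIV) (\<Delta> (Suc n)) (count_space UNIV) (\<lambda>\<omega>. \<Sum>j=1..n. \<Delta> j \<omega>)"
proof -
  have "indep_vars (\<lambda>_. count_space UNIV) \<Delta> {1..}"
    using assms by (simp add: iid_waiting_times_def)
  then have ind: "indep_var (PiM {Suc n} (\<lambda>_. count_space UNIV)) (\<lambda>\<omega>. restrict (\<lambda>i. \<Delta> i \<omega>) {Suc n})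
     (PiM {1..n} (\<lambda>_. count_space UNIV)) (\<lambda>\<omega>. restrict (\<lambda>i. \<Delta> i \<omega>) {1..n})"
    by (rule indep_var_restrict) auto
  have "(\<lambda>f. \<Sum>j=1..n. f j) \<in> borel_measurable (PiM {1..n} (\<lambda>_. count_space (UNIV :: nat set)))"
    by (intro borel_measurable_sum)
       (auto simp: measurable_cong_sets[OF refl sets_borel_eq_count_space])
  then have "(\<lambda>f. \<Sum>j=1..n. f j) \<in> measurable (PiM {1..n} (\<lambda>_. count_space (UNIV :: nat set))) (count_space UNIV)"
    by (simp add: measurable_cong_sets[OF refl sets_borel_eq_count_space])
  then have "indep_var (count_space UNIV) ((\<lambda>f. f (Suc n)) \<circ> (\<lambda>\<omega>. restrict (\<lambda>i. \<Delta> i \<omega>) {Suc n}))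
     (count_space UNIV) ((\<lambda>f. \<Sum>j=1..n. f j) \<circ> (\<lambda>\<omega>. restrict (\<lambda>i. \<Delta> i \<omega>) {1..n}))"
    by (intro indep_var_compose[OF ind]) auto
  then show ?thesis
    by (simp add: comp_def)
qed

text \<open>By independence the law of a sum of waiting times is a convolution of their laws, which
  is a product of generating functions.\<close>

lemma prob_arrival_epoch:
  assumes iid: "iid_waiting_times M \<psi> \<Delta>"
  shows "prob {\<omega> \<in> space M. (\<Sum>j=1..n. \<Delta> j \<omega>) = s} = fps_nth (Abs_fps \<psi> ^ n) s"
proof (induction n arbitrary: s)
  case 0
  show ?case by (auto simp: prob_space)
next
  case (Suc n)
  let ?S = "\<lambda>\<omega>. \<Sum>j=1..n. \<Delta> j \<omega>"
  note [measurable] = arrival_epoch_measurable[OF iid, of n]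
    iid_waiting_times_measurable[OF iid, of "Suc n", simplified]
  have "{\<omega> \<in> space M. (\<Sum>j=1..Suc n. \<Delta> j \<omega>) = s} =
      (\<Union>k\<in>{0..s}. {\<omega> \<in> space M. \<Delta> (Suc n) \<omega> = k \<and> ?S \<omega> = s - k})"
    by auto
  also have "prob \<dots> = (\<Sum>k=0..s. prob {\<omega> \<in> space M. \<Delta> (Suc n) \<omega> = k \<and> ?S \<omega> = s - k})"
    by (intro finite_measure_finite_Union) (auto simp: disjoint_family_on_def simp del: One_nat_def)
  also have "\<dots> = (\<Sum>k=0..s. \<psi> k * fps_nth (Abs_fps \<psi> ^ n) (s - k))"
  proof (rule sum.cong[OF refl])
    fix k
    have "prob {\<omega> \<in> space M. \<Delta> (Suc n) \<omega> = k \<and> ?S \<omega> = s - k} =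
        prob {\<omega> \<in> space M. \<Delta> (Suc n) \<omega> = k} * prob {\<omega> \<in> space M. ?S \<omega> = s - k}"
      using prob_indep_random_variable[OF arrival_epoch_indep[OF iid], of "{k}" "{s - k}" n] by simp
    also have "prob {\<omega> \<in> space M. \<Delta> (Suc n) \<omega> = k} = \<psi> k"
      using iid by (simp add: iid_waiting_times_def)
    finally show "prob {\<omega> \<in> space M. \<Delta> (Suc n) \<omega> = k \<and> ?S \<omega> = s - k} =
        \<psi> k * fps_nth (Abs_fps \<psi> ^ n) (s - k)"
      by (simp only: Suc.IH)
  qed
  finally show ?case
    by (simp add: fps_mult_nth)
qed

lemma prob_arrival_epoch_le:
  assumes iid: "iid_waiting_times M \<psi> \<Delta>"
  shows "prob {\<omega> \<in> space M. (\<Sum>j=1..n. \<Delta> j \<omega>) \<le> t} =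
    fps_nth (Abs_fps \<psi> ^ n * fps_one_minus_powr (-1)) t"
proof -
  note [measurable] = arrival_epoch_measurable[OF iid, of n]
  have "{\<omega> \<in> space M. (\<Sum>j=1..n. \<Delta> j \<omega>) \<le> t} =
      (\<Union>s\<in>{..t}. {\<omega> \<in> space M. (\<Sum>j=1..n. \<Delta> j \<omega>) = s})"
    by auto
  also have "prob \<dots> = (\<Sum>s\<le>t. prob {\<omega> \<in> space M. (\<Sum>j=1..n. \<Delta> j \<omega>) = s})"
    by (intro finite_measure_finite_Union) (auto simp: disjoint_family_on_def simp del: One_nat_def)
  finally show ?thesis
    by (simp only: prob_arrival_epoch[OF iid] sum_fps_nth_le)
qed

lemma AE_waiting_times_positive:
  assumes iid: "iid_waiting_times M \<psi> \<Delta>" and "\<psi> 0 = 0"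
  shows "AE \<omega> in M. \<forall>j\<ge>1. \<Delta> j \<omega> \<noteq> 0"
proof -
  have "AE \<omega> in M. j \<ge> 1 \<longrightarrow> \<Delta> j \<omega> \<noteq> 0" for j
  proof (cases "j \<ge> 1")
    case True
    note [measurable] = iid_waiting_times_measurable[OF iid True]
    have "prob {\<omega> \<in> space M. \<Delta> j \<omega> = 0} = 0"
      using iid True assms(2) by (simp add: iid_waiting_times_def)
    then have "AE \<omega> in M. \<omega> \<notin> {\<omega> \<in> space M. \<Delta> j \<omega> = 0}"
      by (subst prob_eq_0[symmetric]) auto
    with AE_space show ?thesis
      by eventually_elim auto
  qed simp
  then show ?thesis
    by (simp add: AE_all_countable)
qed

end

text \<open>The default value \<open>Max UNIV\<close>, taken when the arrival epochs never pass \<open>t\<close>,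
  has to be tracked only because the event \<open>N t = n\<close> must be measurable.\<close>

lemma counting_process_eq_iff:
  "counting_process \<Delta> t \<omega> = n \<longleftrightarrow>
    (if \<exists>m. \<not> (\<Sum>j=1..m. \<Delta> j \<omega>) \<le> t
     then (\<Sum>j=1..n. \<Delta> j \<omega>) \<le> t \<and> \<not> (\<Sum>j=1..Suc n. \<Delta> j \<omega>) \<le> t
     else n = Max UNIV)"
proof (cases "\<exists>m. \<not> (\<Sum>j=1..m. \<Delta> j \<omega>) \<le> t")
  case True
  let ?A = "{n. (\<Sum>j=1..n. \<Delta> j \<omega>) \<le> t}"
  have down: "m \<in> ?A" if "k \<in> ?A" "m \<le> k" for m k
  proof -
    have "(\<Sum>j=1..m. \<Delta> j \<omega>) \<le> (\<Sum>j=1..k. \<Delta> j \<omega>)"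
      using that by (intro sum_mono2) auto
    then show ?thesis
      using that by auto
  qed
  from True obtain m where "m \<notin> ?A"
    by auto
  then have "?A \<subseteq> {..m}"
    using down by (metis atMost_iff nat_le_linear subsetI)
  then have fin: "finite ?A"
    by (rule finite_subset) simp
  have "0 \<in> ?A"
    by simp
  then have "Max ?A = n \<longleftrightarrow> n \<in> ?A \<and> (\<forall>k\<in>?A. k \<le> n)"
    using fin by (intro Max_eq_iff) blast+
  also have "(\<forall>k\<in>?A. k \<le> n) \<longleftrightarrow> Suc n \<notin> ?A"
    using down by (metis not_less_eq_eq le_refl)
  finally show ?thesis
    unfolding counting_process_def using True by simp
next
  case False
  then have "{n. (\<Sum>j=1..n. \<Delta> j \<omega>) \<le> t} = UNIV"
    by auto
  then show ?thesis
    unfolding counting_process_def using False by auto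
qed

lemma (in prob_space) prob_counting_process:
  assumes iid: "iid_waiting_times M \<psi> \<Delta>" and "\<psi> 0 = 0"
  shows "prob {\<omega> \<in> space M. counting_process \<Delta> t \<omega> = n} =
    fps_nth (Abs_fps \<psi> ^ n * (1 - Abs_fps \<psi>) * fps_one_minus_powr (-1)) t"
proof -
  let ?S = "\<lambda>n \<omega>. \<Sum>j=1..n. \<Delta> j \<omega>"
  let ?E = "\<lambda>n. {\<omega> \<in> space M. ?S n \<omega> \<le> t}"
  note [measurable] = arrival_epoch_measurable[OF iid]
  have "prob {\<omega> \<in> space M. counting_process \<Delta> t \<omega> = n} = prob (?E n - ?E (Suc n))"
  proof (rule finite_measure_eq_AE)
    show "AE \<omega> in M. \<omega> \<in> {\<omega> \<in> space M. counting_process \<Delta> t \<omega> = n} \<longleftrightarrow> \<omega> \<in> ?E n - ?E (Suc n)"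
      using AE_waiting_times_positive[OF assms]
    proof eventually_elim
      case (elim \<omega>)
      have "m \<le> ?S m \<omega>" for m
        using sum_mono[of "{1..m}" "\<lambda>_. 1" "\<lambda>j. \<Delta> j \<omega>"] elim by (auto simp: Suc_le_eq)
      then have "\<exists>m. \<not> ?S m \<omega> \<le> t"
        by (metis not_less_eq_eq)
      then show ?case
        by (auto simp: counting_process_eq_iff simp del: sum.cl_ivl_Suc)
    qed
  next
    show "{\<omega> \<in> space M. counting_process \<Delta> t \<omega> = n} \<in> events"
      unfolding counting_process_eq_iff by measurable
  qed measurable
  also have "\<dots> = prob (?E n) - prob (?E (Suc n))"
    proof (rule finite_measure_Diff)
    show "?E (Suc n) \<subseteq> ?E n"
      by auto
  qed measurable
  also have "\<dots> = fps_nth (Abs_fps \<psi> ^ n * fps_one_minus_powr (-1)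
      - Abs_fps \<psi> ^ Suc n * fps_one_minus_powr (-1)) t"
    by (simp only: prob_arrival_epoch_le[OF iid] fps_sub_nth)
  finally show ?thesis
    by (simp add: algebra_simps)
qed

lemma (in prob_space) prob_sibuya_counting_process:
  assumes "iid_waiting_times M (sibuya_density \<beta>) \<Delta>"
  shows "prob {\<omega> \<in> space M. counting_process \<Delta> t \<omega> = n} =
    fps_nth ((1 - fps_one_minus_powr \<beta>) ^ n * fps_one_minus_powr (\<beta> - 1)) t"
proof -
  have "sibuya_density \<beta> 0 = 0"
    by (simp add: sibuya_density_def)
  from prob_counting_process[OF assms this] show ?thesis
    by (simp add: sibuya_fps mult.assoc fps_one_minus_powr_mult)
qed

section \<open>The transition matrix\<close>

theorem mainTheorem8:
  fixes \<beta> :: real and M :: "'a measure" and \<Delta> :: "nat \<Rightarrow> 'a \<Rightarrow> nat" and Wp Wm :: zmatrix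
  assumes "0 < \<beta>" and "\<beta> < 1"
    and "prob_space M"
    and "iid_waiting_times M (sibuya_density \<beta>) \<Delta>"
    and "zmat_stochastic Wp" and "zmat_toeplitz Wp" and "\<And>p q. \<not> q > p \<Longrightarrow> Wp p q = 0"
    and "zmat_stochastic Wm" and "zmat_toeplitz Wm" and "\<And>p q. \<not> q < p \<Longrightarrow> Wm p q = 0"
  shows "\<forall>t::nat. adtrw_transition M (counting_process \<Delta>) Wp Wm t =
    (\<lambda>p q. (-1) ^ t / fact t *
       (\<Sum>n=0..t. zmat_mult (zmat_power Wm (t - n)) (zmat_power Wp n) p q *
          (\<Sum>l=0..n. (-1) ^ l * real (n choose l) *
             (Gamma (\<beta> * (real l + 1)) * rGamma (\<beta> * (real l + 1) - real t)))))"
proof (intro allI ext)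
  fix t :: nat and p q :: int
  interpret prob_space M
    by fact
  let ?W = "\<lambda>n. zmat_mult (zmat_power Wm (t - n)) (zmat_power Wp n) p q"
  let ?c = "\<lambda>n. \<Sum>l=0..n. (-1) ^ l * real (n choose l) *
    (Gamma (\<beta> * (real l + 1)) * rGamma (\<beta> * (real l + 1) - real t))"
  have comm: "zmat_mult (zmat_power Wp n) (zmat_power Wm (t - n)) p q = ?W n" for n
    using assms by (simp add: zmat_mult_toeplitz_commute zmat_toeplitz_power)
  have law: "prob {\<omega> \<in> space M. counting_process \<Delta> t \<omega> = n} = (-1) ^ t / fact t * ?c n" for n
    using assms by (simp only: prob_sibuya_counting_process fps_nth_sibuya_count)
  show "adtrw_transition M (counting_process \<Delta>) Wp Wm t p q =
      (-1) ^ t / fact t * (\<Sum>n=0..t. ?W n * ?c n)"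
    unfolding adtrw_transition_def comm law sum_distrib_left[of _ _ "{0..t}"]
    by (intro sum.cong refl) (simp only: mult_ac)
qed

end
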